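(* Let $\mathbf b=\{b_n\}_{n=1}^{\infty}$ be a nonnegative real sequence. Suppose there exist a natural number $N_0$ and a constant $M(\mathbf b)>0$ such that $$\sum_{n=m}^{2m}|b_n-b_{n+1}|\le M(\mathbf b)\max_{m\le n<m+N_0}b_n\qquad\text{for all } m=1,2,\dots.$$ Then each of the following two properties holds if and only if $\lim_{n\to\infty}nb_n=0$: (i) the series $\sum_{n=1}^{\infty}b_n\sin nx$ converges uniformly on $\mathbb R$; (ii) the series $\sum_{n=1}^\infty b_n\sin nx$ converges everywhere and its sum function $f(x)$ is continuous. *)

theory Defs
  imports "HOL-Analysis.Analysis"
begin

end

theory Submission
  imports Defs "HOL-Probability.Sinc_Integral"
begin

text \<open>If \<open>n b\<^sub>n \<rightarrow> 0\<close>, the hypothesis applied along \<open>m, 2m, 4m, \<dots>\<close> bounds the total variation of \<open>b\<close>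
  beyond \<open>m\<close> by \<open>o(1/m)\<close>. A block of the series is then split at \<open>n \<approx> 1/\<bar>sin (x/2)\<bar>\<close>: below, use
  \<open>\<bar>sin nx\<bar> \<le> 2n \<bar>sin (x/2)\<bar>\<close>, above, use Abel summation.

  Conversely, let the series converge everywhere to a continuous \<open>f\<close>. By Cantor--Lebesgue
  \<open>b\<^sub>n \<rightarrow> 0\<close>, so \<open>R x = \<Sum> b\<^sub>n sin (nx) / n\<^sup>2\<close> is continuous, and by Riemann its symmetric second
  derivative is \<open>-f\<close>. A maximum principle turns \<open>f 0 = 0\<close> into \<open>2 R x - R (2x) \<le> o(x\<^sup>2)\<close>. Integrating
  over \<open>0 \<le> x \<le> 1/k\<close> gives a series with nonnegative terms \<open>b\<^sub>n (1 - cos (n/k))\<^sup>2 / n\<^sup>3\<close>, whence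
  \<open>\<Sum>\<^sub>n\<^sub>\<le>\<^sub>k n b\<^sub>n = o(k)\<close>. By hypothesis \<open>b\<^sub>k\<close> is bounded by a multiple of the maximum of \<open>b\<close> over every
  window of length \<open>N0\<close> starting between \<open>k/2\<close> and \<open>k\<close>, so \<open>k b\<^sub>k \<rightarrow> 0\<close>.\<close>

section \<open>Variation and Abel summation\<close>

definition variation :: "(nat \<Rightarrow> real) \<Rightarrow> nat \<Rightarrow> nat \<Rightarrow> real" where
  "variation c m N = (\<Sum>n=m..<N. \<bar>c n - c (Suc n)\<bar>)"

lemma variation_nonneg: "0 \<le> variation c m N"
  by (simp add: variation_def sum_nonneg)

lemma variation_mono: "m \<le> m' \<Longrightarrow> N' \<le> N \<Longrightarrow> variation c m' N' \<le> variation c m N"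
  unfolding variation_def by (intro sum_mono2) auto

lemma variation_le_add: "variation c m N \<le> variation c m p + variation c p N"
proof -
  have "variation c m N \<le> (\<Sum>n\<in>{m..<p} \<union> {p..<N}. \<bar>c n - c (Suc n)\<bar>)"
    unfolding variation_def by (intro sum_mono2) auto
  also have "\<dots> = variation c m p + variation c p N"
    unfolding variation_def by (intro sum.union_disjoint) auto
  finally show ?thesis .
qed

lemma abs_diff_le_variation:
  assumes "m \<le> N"
  shows "\<bar>c N - c m\<bar> \<le> variation c m N"
proof -
  have "c N - c m = (\<Sum>n=m..<N. c (Suc n) - c n)"
    by (rule sum_Suc_diff'[OF assms, symmetric])
  also have "\<bar>\<dots>\<bar> \<le> (\<Sum>n=m..<N. \<bar>c (Suc n) - c n\<bar>)"
    by (rule sum_abs)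
  finally show ?thesis
    by (simp add: variation_def abs_minus_commute)
qed

lemma abs_abel_sum_le:
  fixes a c :: "nat \<Rightarrow> real"
  assumes "\<And>k. k \<le> N \<Longrightarrow> \<bar>\<Sum>n=m..<k. a n\<bar> \<le> A"
  shows "\<bar>\<Sum>n=m..<N. a n * c n\<bar> \<le> A * (\<bar>c N\<bar> + variation c m N)"
proof -
  define S where "S k = (\<Sum>n=m..<k. a n)" for k
  have "(\<Sum>n=m..<N. a n * c n) = S N * c N + (\<Sum>n=m..<N. S (Suc n) * (c n - c (Suc n)))"
    by (induction N) (auto simp: S_def algebra_simps)
  also have "\<bar>\<dots>\<bar> \<le> \<bar>S N * c N\<bar> + (\<Sum>n=m..<N. \<bar>S (Suc n) * (c n - c (Suc n))\<bar>)"
    by (rule order_trans[OF abs_triangle_ineq]) (intro add_left_mono sum_abs)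
  also have "\<dots> \<le> A * \<bar>c N\<bar> + (\<Sum>n=m..<N. A * \<bar>c n - c (Suc n)\<bar>)"
    unfolding abs_mult S_def by (intro add_mono sum_mono mult_right_mono assms) auto
  finally show ?thesis
    by (simp add: variation_def sum_distrib_left distrib_left)
qed

lemma uniformly_convergent_on_sum_mult_if_variation_bounded:
  fixes a :: "nat \<Rightarrow> real" and c :: "'b \<Rightarrow> nat \<Rightarrow> real"
  assumes "summable a"
    and bounded: "\<And>h n. h \<in> S \<Longrightarrow> \<bar>c h n\<bar> \<le> B"
    and variation: "\<And>h N. h \<in> S \<Longrightarrow> variation (c h) 0 N \<le> V"
  shows "uniformly_convergent_on S (\<lambda>N h. \<Sum>n<N. a n * c h n)"
proof (cases "S = {}")
  case False
  then obtain h where "h \<in> S" by blast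
  then have "0 \<le> B" "0 \<le> V"
    using bounded[of h 0] variation[of h 0] by (auto simp: variation_def)
  show ?thesis
    unfolding uniformly_convergent_on_sum_iff
  proof (intro allI impI)
    fix e :: real assume "e > 0"
    define d where "d = e / (B + V + 1)"
    have d: "d > 0" "d * (B + V) < e"
      using \<open>e > 0\<close> \<open>0 \<le> B\<close> \<open>0 \<le> V\<close> by (auto simp: d_def field_simps)
    obtain m0 where m0: "\<And>m N. m \<ge> m0 \<Longrightarrow> \<bar>\<Sum>n=m..<N. a n\<bar> < d"
      using assms(1) d(1) unfolding summable_Cauchy real_norm_def by blast
    have "norm (\<Sum>n=m..<N. a n * c h n) < e" if "m \<ge> m0" "h \<in> S" for m N h
    proof -
      have "\<bar>\<Sum>n=m..<N. a n * c h n\<bar> \<le> d * (\<bar>c h N\<bar> + variation (c h) m N)"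
        using m0 that by (intro abs_abel_sum_le less_imp_le) auto
      also have "\<dots> \<le> d * (B + V)"
        using d(1) bounded variation[of h N] variation_mono[of 0 m N N "c h"] that
        by (intro mult_left_mono add_mono) auto
      finally show ?thesis using d(2) by simp
    qed
    then show "\<exists>m0. \<forall>m N h. m0 \<le> m \<longrightarrow> m \<le> N \<longrightarrow> h \<in> S \<longrightarrow> norm (\<Sum>n=m..<N. a n * c h n) < e"
      by blast
  qed
qed simp

lemma suminf_mult_tendsto_if_variation_bounded:
  fixes a :: "nat \<Rightarrow> real" and c :: "'b \<Rightarrow> nat \<Rightarrow> real"
  assumes a: "a sums s"
    and "\<And>h n. h \<in> S \<Longrightarrow> \<bar>c h n\<bar> \<le> B"
    and "\<And>h N. h \<in> S \<Longrightarrow> variation (c h) 0 N \<le> V"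
    and c: "\<And>n. ((\<lambda>h. c h n) \<longlongrightarrow> 1) F" and "\<forall>\<^sub>F h in F. h \<in> S"
  shows "((\<lambda>h. \<Sum>n. a n * c h n) \<longlongrightarrow> s) F"
proof -
  have "uniformly_convergent_on S (\<lambda>N h. \<Sum>n<N. a n * c h n)"
    using sums_summable[OF a] assms(2,3)
    by (rule uniformly_convergent_on_sum_mult_if_variation_bounded)
  then have limit: "uniform_limit S (\<lambda>N h. \<Sum>n<N. a n * c h n) (\<lambda>h. \<Sum>n. a n * c h n) sequentially"
    by (simp add: uniformly_convergent_uniform_limit_iff suminf_eq_lim)
  show ?thesis
  proof (rule swap_uniform_limit'[OF _ _ limit assms(5)])
    show "\<forall>\<^sub>F N in sequentially. ((\<lambda>h. \<Sum>n<N. a n * c h n) \<longlongrightarrow> (\<Sum>n<N. a n * 1)) F"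
      by (intro always_eventually allI tendsto_sum tendsto_mult_left c)
    show "(\<lambda>N. \<Sum>n<N. a n * 1) \<longlonglongrightarrow> s"
      using a by (simp add: sums_def)
  qed simp
qed

section \<open>Trigonometric estimates\<close>

lemma abs_sin_of_nat_mult_le: "\<bar>sin (real n * y)\<bar> \<le> real n * \<bar>sin y\<bar>"
proof (induction n)
  case (Suc n)
  have "\<bar>sin (real (Suc n) * y)\<bar> \<le> \<bar>sin (real n * y)\<bar> * \<bar>cos y\<bar> + \<bar>cos (real n * y)\<bar> * \<bar>sin y\<bar>"
    using abs_triangle_ineq[of "sin (real n * y) * cos y" "cos (real n * y) * sin y"]
    by (simp add: distrib_right sin_add abs_mult algebra_simps)
  also have "\<dots> \<le> \<bar>sin (real n * y)\<bar> * 1 + 1 * \<bar>sin y\<bar>"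
    by (intro add_mono mult_left_mono mult_right_mono) auto
  finally show ?case
    using Suc by (simp add: algebra_simps)
qed simp

lemma abs_sin_of_nat_mult_le_half: "\<bar>sin (real n * x)\<bar> \<le> 2 * real n * \<bar>sin (x / 2)\<bar>"
  using abs_sin_of_nat_mult_le[of "2 * n" "x / 2"] by simp

lemma abs_sum_sin_mult_sin_half_le: "\<bar>\<Sum>n=m..<N. sin (real n * x)\<bar> * \<bar>sin (x / 2)\<bar> \<le> 1"
proof (cases "m \<le> N")
  case True
  define C where "C n = cos ((real n - 1 / 2) * x)" for n :: nat
  have telescoping: "2 * sin (x / 2) * sin (real n * x) = - (C (Suc n) - C n)" for n
  proof -
    have "cos (real n * x - x / 2) - cos (real n * x + x / 2) = 2 * sin (x / 2) * sin (real n * x)"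
      by (simp add: cos_add cos_diff)
    moreover have "(real n - 1 / 2) * x = real n * x - x / 2"
      "(real (Suc n) - 1 / 2) * x = real n * x + x / 2"
      by (simp_all add: field_simps)
    ultimately show ?thesis
      by (simp add: C_def)
  qed
  have "2 * sin (x / 2) * (\<Sum>n=m..<N. sin (real n * x)) = C m - C N"
    using sum_Suc_diff'[OF True, of C]
    by (simp add: sum_distrib_left telescoping sum_negf del: minus_diff_eq)
  moreover have "\<bar>C m - C N\<bar> \<le> 2"
    using abs_triangle_ineq4[of "C m" "C N"] abs_cos_le_one[of "(real m - 1 / 2) * x"]
      abs_cos_le_one[of "(real N - 1 / 2) * x"] unfolding C_def by linarith
  ultimately have "\<bar>2 * sin (x / 2) * (\<Sum>n=m..<N. sin (real n * x))\<bar> \<le> 2"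
    by simp
  then show ?thesis
    by (simp add: abs_mult mult.commute)
qed simp

lemma one_minus_cos_ge_quarter_square:
  fixes u :: real
  assumes "\<bar>u\<bar> \<le> 1"
  shows "u^2 / 4 \<le> 1 - cos u"
proof -
  obtain t where "cos u = (\<Sum>m<4. cos_coeff m * u ^ m) + cos (t + 1/2 * real 4 * pi) / fact 4 * u ^ 4"
    using Maclaurin_cos_expansion[of u 4] by blast
  moreover have "{..<4::nat} = {0, 1, 2, 3}"
    by auto
  ultimately have "cos u = 1 - u^2 / 2 + cos t * (u ^ 4 / 24)"
    by (simp add: cos_coeff_def fact_numeral)
  also have "\<dots> \<le> 1 - u^2 / 2 + 1 * (u ^ 4 / 24)"
    by (intro add_left_mono mult_right_mono cos_le_one) auto
  also have "u ^ 4 \<le> u^2"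
    using power_decreasing[of 2 4 "\<bar>u\<bar>"] assms by simp
  finally show ?thesis
    using zero_le_power2[of u] by linarith
qed

section \<open>Uniform convergence\<close>

lemma abs_sine_sum_le_mult:
  assumes "\<And>n. n \<ge> m \<Longrightarrow> \<bar>real n * b n\<bar> \<le> e"
  shows "\<bar>\<Sum>n=m..<N. b n * sin (real n * x)\<bar> \<le> 2 * e * (real N * \<bar>sin (x / 2)\<bar>)"
proof -
  have "0 \<le> e"
    using assms[of m] by linarith
  have "norm (b n * sin (real n * x)) \<le> 2 * e * \<bar>sin (x / 2)\<bar>" if "n \<in> {m..<N}" for n
  proof -
    have "\<bar>b n * sin (real n * x)\<bar> \<le> \<bar>b n\<bar> * (2 * real n * \<bar>sin (x / 2)\<bar>)"
      unfolding abs_mult by (intro mult_left_mono abs_sin_of_nat_mult_le_half) auto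
    also have "\<dots> = 2 * \<bar>real n * b n\<bar> * \<bar>sin (x / 2)\<bar>"
      by (simp add: abs_mult)
    also have "\<dots> \<le> 2 * e * \<bar>sin (x / 2)\<bar>"
      using assms that by (intro mult_right_mono) auto
    finally show ?thesis by simp
  qed
  then have "norm (\<Sum>n=m..<N. b n * sin (real n * x)) \<le> real (card {m..<N}) * (2 * e * \<bar>sin (x / 2)\<bar>)"
    by (rule sum_norm_bound)
  also have "\<dots> \<le> real N * (2 * e * \<bar>sin (x / 2)\<bar>)"
    using \<open>0 \<le> e\<close> by (intro mult_right_mono) auto
  finally show ?thesis by (simp add: mult_ac)
qed

lemma abs_sine_sum_mult_sin_half_le:
  "\<bar>\<Sum>n=m..<N. b n * sin (real n * x)\<bar> * \<bar>sin (x / 2)\<bar> \<le> \<bar>b N\<bar> + variation b m N"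
proof (cases "sin (x / 2) = 0")
  case False
  have "\<bar>\<Sum>n=m..<N. sin (real n * x) * b n\<bar> \<le> 1 / \<bar>sin (x / 2)\<bar> * (\<bar>b N\<bar> + variation b m N)"
    using abs_sum_sin_mult_sin_half_le False by (intro abs_abel_sum_le) (auto simp: field_simps)
  with False show ?thesis
    by (simp add: field_simps)
qed (simp add: variation_nonneg)

lemma ex_of_nat_mult_between_1_2:
  fixes s :: real
  assumes "0 < s" "s \<le> 1"
  shows "\<exists>q::nat. 1 \<le> real q * s \<and> real q * s \<le> 2"
proof -
  define q where "q = nat \<lceil>1 / s\<rceil>"
  have "1 / s \<le> real q" "real q \<le> 1 / s + 1"
    using assms by (auto simp: q_def of_nat_ceiling)
  then have "1 \<le> real q * s" "real q * s \<le> 2"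
    using assms by (auto simp: field_simps)
  then show ?thesis
    by blast
qed

locale dyadic_variation_bounded =
  fixes b :: "nat \<Rightarrow> real" and N0 :: nat and M :: real
  assumes nonneg: "n \<ge> 1 \<Longrightarrow> b n \<ge> 0"
    and N0_pos: "N0 \<ge> 1"
    and M_pos: "M > 0"
    and dyadic_variation_le: "m \<ge> 1 \<Longrightarrow> variation b m (Suc (2 * m)) \<le> M * Max (b ` {m..<m+N0})"
begin

lemma dyadic_variation_le_divide:
  assumes "m \<ge> 1" and small: "\<And>n. n \<ge> m \<Longrightarrow> real n * b n \<le> e"
  shows "variation b m (Suc (2 * m)) \<le> M * (e / real m)"
proof -
  have "b n \<le> e / real m" if "n \<in> {m..<m+N0}" for n
  proof -
    have "real m * b n \<le> real n * b n"
      using that nonneg[of n] \<open>m \<ge> 1\<close> by (intro mult_right_mono) auto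
    also have "\<dots> \<le> e"
      using that by (intro small) auto
    finally show ?thesis
      using \<open>m \<ge> 1\<close> by (simp add: field_simps)
  qed
  then have "Max (b ` {m..<m+N0}) \<le> e / real m"
    using N0_pos by (subst Max_le_iff) auto
  then show ?thesis
    using M_pos by (intro order_trans[OF dyadic_variation_le[OF assms(1)]] mult_left_mono) auto
qed

lemma tail_variation_le:
  assumes "m \<ge> 1" and "\<And>n. n \<ge> m \<Longrightarrow> real n * b n \<le> e"
  shows "variation b m N \<le> 2 * M * e / real m"
  using assms
proof (induction "N - m" arbitrary: m rule: less_induct)
  case less
  have "0 \<le> real m * b m"
    using nonneg less.prems(1) by simp
  then have "0 \<le> e"
    using less.prems(2)[of m] by linarith
  show ?case
  proof (cases "N \<le> m")
    case True
    with \<open>0 \<le> e\<close> M_pos show ?thesis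
      by (simp add: variation_def)
  next
    case False
    have "variation b m N \<le> variation b m (2 * m) + variation b (2 * m) N"
      by (rule variation_le_add)
    also have "\<dots> \<le> variation b m (Suc (2 * m)) + variation b (2 * m) N"
      by (intro add_right_mono variation_mono) auto
    also have "\<dots> \<le> M * (e / real m) + 2 * M * e / real (2 * m)"
      using less.prems False by (intro add_mono dyadic_variation_le_divide less.hyps) auto
    also have "\<dots> = 2 * M * e / real m"
      by (simp add: field_simps)
    finally show ?thesis .
  qed
qed

lemma abs_sine_sum_le_divide:
  assumes "m \<ge> 1" and small: "\<And>n. n \<ge> m \<Longrightarrow> real n * b n \<le> e"
    and large: "1 \<le> real m * \<bar>sin (x / 2)\<bar>"
  shows "\<bar>\<Sum>n=m..<N. b n * sin (real n * x)\<bar> \<le> (1 + 2 * M) * e"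
proof (cases "m \<le> N")
  case True
  let ?S = "\<bar>\<Sum>n=m..<N. b n * sin (real n * x)\<bar>"
  have "real m * b N \<le> real N * b N"
    using True nonneg[of N] \<open>m \<ge> 1\<close> by (intro mult_right_mono) auto
  also have "\<dots> \<le> e"
    using small True .
  finally have last: "real m * \<bar>b N\<bar> \<le> e"
    using nonneg[of N] True \<open>m \<ge> 1\<close> by simp
  have variation: "real m * variation b m N \<le> 2 * M * e"
    using tail_variation_le[OF assms(1,2)] \<open>m \<ge> 1\<close> by (simp add: field_simps)
  have "?S \<le> ?S * (real m * \<bar>sin (x / 2)\<bar>)"
    using mult_left_mono[OF large, of ?S] by simp
  also have "\<dots> = real m * (?S * \<bar>sin (x / 2)\<bar>)"
    by simp
  also have "\<dots> \<le> real m * (\<bar>b N\<bar> + variation b m N)"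
    by (intro mult_left_mono abs_sine_sum_mult_sin_half_le) auto
  also have "\<dots> \<le> (1 + 2 * M) * e"
    using last variation by (simp add: algebra_simps)
  finally show ?thesis .
next
  case False
  have "0 \<le> real m * b m"
    using nonneg \<open>m \<ge> 1\<close> by simp
  then show ?thesis
    using small[of m] M_pos False by simp
qed

lemma abs_sine_sum_le:
  assumes "m \<ge> 1" and small: "\<And>n. n \<ge> m \<Longrightarrow> real n * b n \<le> e"
  shows "\<bar>\<Sum>n=m..<N. b n * sin (real n * x)\<bar> \<le> (5 + 2 * M) * e"
proof -
  have small_abs: "\<bar>real n * b n\<bar> \<le> e" if "n \<ge> m" for n
    using small[OF that] nonneg[of n] that \<open>m \<ge> 1\<close> by simp
  then have "0 \<le> e"
    using abs_ge_zero order_trans by blast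
  define s where "s = \<bar>sin (x / 2)\<bar>"
  have low: "\<bar>\<Sum>n=m..<K. b n * sin (real n * x)\<bar> \<le> 4 * e" if "real K * s \<le> 2" for K
    using abs_sine_sum_le_mult[of m b e x K, OF small_abs] mult_left_mono[OF that, of "2 * e"] \<open>0 \<le> e\<close>
    by (simp add: s_def)
  show ?thesis
  proof (cases "s = 0")
    case True
    with low[of N] have "\<bar>\<Sum>n=m..<N. b n * sin (real n * x)\<bar> \<le> 4 * e"
      by simp
    also have "\<dots> \<le> (5 + 2 * M) * e"
      using M_pos \<open>0 \<le> e\<close> by (intro mult_right_mono) auto
    finally show ?thesis .
  next
    case False
    then have "0 < s" "s \<le> 1"
      by (auto simp: s_def)
    then obtain q :: nat where q: "1 \<le> real q * s" "real q * s \<le> 2"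
      using ex_of_nat_mult_between_1_2 by blast
    have s_mono: "real k * s \<le> real l * s" if "k \<le> l" for k l
      using that \<open>0 < s\<close> by (intro mult_right_mono) auto
    have "{m..<N} = {m..<min N q} \<union> {max m q..<N}"
      by auto
    then have "(\<Sum>n=m..<N. b n * sin (real n * x))
        = (\<Sum>n=m..<min N q. b n * sin (real n * x)) + (\<Sum>n=max m q..<N. b n * sin (real n * x))"
      by (simp add: sum.union_disjoint)
    moreover have "\<bar>\<Sum>n=m..<min N q. b n * sin (real n * x)\<bar> \<le> 4 * e"
      using s_mono[of "min N q" q] q(2) by (intro low) auto
    moreover have "\<bar>\<Sum>n=max m q..<N. b n * sin (real n * x)\<bar> \<le> (1 + 2 * M) * e"
      using assms s_mono[of q "max m q"] q(1) by (intro abs_sine_sum_le_divide) (auto simp: s_def)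
    ultimately show ?thesis
      by (simp add: algebra_simps)
  qed
qed

lemma uniformly_convergent_sine_series:
  assumes "(\<lambda>n. real n * b n) \<longlonglongrightarrow> 0"
  shows "uniformly_convergent_on UNIV (\<lambda>N x. \<Sum>n<N. b n * sin (real n * x))"
  unfolding uniformly_convergent_on_sum_iff
proof (intro allI impI)
  fix e :: real assume "e > 0"
  define d where "d = e / (6 + 2 * M)"
  have d: "d > 0" "(5 + 2 * M) * d < e"
    using M_pos \<open>e > 0\<close> by (auto simp: d_def field_simps)
  obtain m0 where m0: "\<And>n. n \<ge> m0 \<Longrightarrow> \<bar>real n * b n\<bar> < d"
    using LIMSEQ_D[OF assms d(1)] by auto
  have "norm (\<Sum>n=m..<N. b n * sin (real n * x)) < e" if "m \<ge> Suc m0" for m N x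
  proof -
    have "real n * b n \<le> d" if "n \<ge> m" for n
      using m0[of n] that \<open>m \<ge> Suc m0\<close> by simp
    then show ?thesis
      using abs_sine_sum_le[of m d x N] that d(2) by simp
  qed
  then show "\<exists>m0. \<forall>m N x. m0 \<le> m \<longrightarrow> m \<le> N \<longrightarrow> x \<in> UNIV \<longrightarrow> norm (\<Sum>n=m..<N. b n * sin (real n * x)) < e"
    by blast
qed

end

section \<open>The Cantor--Lebesgue theorem\<close>

lemma has_integral_sin_of_nat_mult_square:
  assumes "n \<ge> 1"
  shows "((\<lambda>x. (sin (real n * x))^2) has_integral pi) {0..2 * pi}"
proof -
  define P where "P x = x / 2 - sin (2 * (real n * x)) / (4 * real n)" for x
  have "((\<lambda>x. (sin (real n * x))^2) has_integral (P (2 * pi) - P 0)) {0..2 * pi}"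
  proof (rule fundamental_theorem_of_calculus)
    fix x :: real
    have "(P has_real_derivative 1 / 2 - cos (2 * (real n * x)) / 2) (at x within {0..2 * pi})"
      using assms unfolding P_def by (auto intro!: derivative_eq_intros simp: field_simps)
    also have "1 / 2 - cos (2 * (real n * x)) / 2 = (sin (real n * x))^2"
      unfolding cos_double_sin by (simp add: field_simps)
    finally show "(P has_vector_derivative (sin (real n * x))^2) (at x within {0..2 * pi})"
      by (simp only: has_real_derivative_iff_has_vector_derivative)
  qed simp
  moreover have "sin (2 * (real n * (2 * pi))) = 0"
    using sin_npi[of "4 * n"] by (simp add: mult_ac)
  ultimately show ?thesis
    by (simp add: P_def)
qed

lemma tendsto_0_if_square_over_one_plus_square:
  fixes y :: "'a \<Rightarrow> real"
  assumes "((\<lambda>n. (y n)^2 / (1 + (y n)^2)) \<longlongrightarrow> 0) F"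
  shows "(y \<longlongrightarrow> 0) F"
proof -
  have "(y n)^2 = (y n)^2 / (1 + (y n)^2) / (1 - (y n)^2 / (1 + (y n)^2))" for n
  proof -
    have "1 + (y n)^2 > 0"
      by (simp add: add_pos_nonneg)
    moreover from this have "1 - (y n)^2 / (1 + (y n)^2) = 1 / (1 + (y n)^2)"
      by (simp add: field_simps)
    ultimately show ?thesis
      by simp
  qed
  moreover have "((\<lambda>n. (y n)^2 / (1 + (y n)^2) / (1 - (y n)^2 / (1 + (y n)^2))) \<longlongrightarrow> 0 / (1 - 0)) F"
    by (intro tendsto_divide tendsto_diff assms tendsto_const) auto
  ultimately have "((\<lambda>n. (y n)^2) \<longlongrightarrow> 0) F"
    by simp
  then have "((\<lambda>n. sqrt ((y n)^2)) \<longlongrightarrow> sqrt 0) F"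
    by (rule tendsto_real_sqrt)
  then show ?thesis
    by (simp add: tendsto_rabs_zero_iff)
qed

text \<open>Dividing \<open>(b\<^sub>n sin nx)\<^sup>2\<close> by \<open>1 + b\<^sub>n\<^sup>2\<close> makes it bounded, so that dominated convergence applies.\<close>

lemma cantor_lebesgue_sin:
  fixes b :: "nat \<Rightarrow> real"
  assumes "\<And>x. x \<in> {0..2 * pi} \<Longrightarrow> (\<lambda>n. b n * sin (real n * x)) \<longlonglongrightarrow> 0"
  shows "b \<longlonglongrightarrow> 0"
proof -
  define w where "w n = (b n)^2 / (1 + (b n)^2)" for n
  have w: "0 \<le> w n" "w n \<le> 1" "w n \<le> (b n)^2" for n
    by (auto simp: w_def field_simps add_pos_nonneg)
  have integral: "((\<lambda>x. w n * (sin (real n * x))^2) has_integral w n * pi) {0..2 * pi}" if "n \<ge> 1" for n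
    using has_integral_sin_of_nat_mult_square[OF that] by (rule has_integral_mult_right)
  have "(\<lambda>n. integral {0..2 * pi} (\<lambda>x. w n * (sin (real n * x))^2)) \<longlonglongrightarrow> integral {0..2 * pi} (\<lambda>x. 0)"
  proof (rule dominated_convergence)
    show "(\<lambda>x. w n * (sin (real n * x))^2) integrable_on {0..2 * pi}" for n
      by (intro integrable_continuous_interval continuous_intros)
    show "(\<lambda>x. 1::real) integrable_on {0..2 * pi}"
      by (rule integrable_const_ivl)
    show "norm (w n * (sin (real n * x))^2) \<le> 1" for n x
      using w[of n] by (simp add: abs_mult mult_le_one abs_square_le_1)
    show "(\<lambda>n. w n * (sin (real n * x))^2) \<longlonglongrightarrow> 0" if "x \<in> {0..2 * pi}" for x
    proof (rule tendsto_sandwich[of "\<lambda>_. 0"])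
      show "(\<lambda>n. (b n * sin (real n * x))^2) \<longlonglongrightarrow> 0"
        using assms that by (intro tendsto_null_power) auto
    qed (use w in \<open>auto simp: power_mult_distrib mult_right_mono\<close>)
  qed
  moreover have "\<forall>\<^sub>F n in sequentially. integral {0..2 * pi} (\<lambda>x. w n * (sin (real n * x))^2) = w n * pi"
    using eventually_ge_at_top[of 1] by eventually_elim (rule integral_unique[OF integral])
  ultimately have "(\<lambda>n. w n * pi) \<longlonglongrightarrow> 0"
    by (simp add: Lim_transform_eventually)
  then have "w \<longlonglongrightarrow> 0"
    using tendsto_divide[of "\<lambda>n. w n * pi" 0 sequentially "\<lambda>_. pi" pi] by simp
  then show ?thesis
    unfolding w_def by (rule tendsto_0_if_square_over_one_plus_square)
qed

section \<open>Riemann summation\<close>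

definition sinc_square :: "real \<Rightarrow> real" where
  "sinc_square u = (sinc u)^2"

lemma sinc_square_0: "sinc_square 0 = 1"
  by (simp add: sinc_square_def)

lemma isCont_sinc_square: "isCont sinc_square u"
  unfolding sinc_square_def[abs_def] by (intro continuous_power isCont_sinc)

lemma abs_sinc_square_le_1: "\<bar>sinc_square u\<bar> \<le> 1"
proof -
  have "\<bar>sinc u\<bar> \<le> 1"
    using abs_sin_x_le_abs_x[of u] by simp
  then show ?thesis
    by (simp add: sinc_square_def abs_square_le_1)
qed

lemma sinc_square_abs: "sinc_square \<bar>u\<bar> = sinc_square u"
  by (simp add: sinc_square_def abs_if)

lemma abs_sin_minus_mult_cos_le_square:
  fixes u :: real
  assumes "0 < u"
  shows "\<bar>sin u - u * cos u\<bar> \<le> u^2"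
proof -
  have "\<exists>z>0. z < u \<and> (\<lambda>u. sin u - u * cos u) u - (\<lambda>u. sin u - u * cos u) 0 = (u - 0) * (z * sin z)"
    using assms by (intro MVT2) (auto intro!: derivative_eq_intros)
  then obtain z where z: "0 < z" "z < u" "sin u - u * cos u = u * (z * sin z)"
    by auto
  have "\<bar>sin u - u * cos u\<bar> = u * (z * \<bar>sin z\<bar>)"
    using z assms by (simp add: abs_mult)
  also have "\<dots> \<le> u * (u * 1)"
    using z assms by (intro mult_left_mono mult_mono) auto
  finally show ?thesis
    by (simp add: power2_eq_square)
qed

definition sinc_square_deriv :: "real \<Rightarrow> real" where
  "sinc_square_deriv u = 2 * (sin u / u) * ((u * cos u - sin u) / u^2)"

lemma sinc_square_has_derivative:
  assumes "u > 0"
  shows "(sinc_square has_real_derivative sinc_square_deriv u) (at u)"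
proof (rule has_field_derivative_transform_within_open)
  show "((\<lambda>u. (sin u / u)^2) has_real_derivative sinc_square_deriv u) (at u)"
    using assms unfolding sinc_square_deriv_def
    by (auto intro!: derivative_eq_intros simp: divide_simps)
       (simp add: power2_eq_square power4_eq_xxxx algebra_simps)
qed (use assms in \<open>auto simp: sinc_square_def intro: open_greaterThan[of 0]\<close>)

lemma abs_sinc_square_deriv_le:
  assumes "u > 0"
  shows "\<bar>sinc_square_deriv u\<bar> \<le> 6 * inverse (1 + u^2)"
proof -
  define w where "w = \<bar>sin u - u * cos u\<bar>"
  have deriv_eq: "\<bar>sinc_square_deriv u\<bar> = 2 * (\<bar>sin u\<bar> / u) * (w / u^2)"
    using assms by (simp add: sinc_square_deriv_def w_def abs_mult abs_minus_commute)
  have "\<bar>sinc_square_deriv u\<bar> \<le> 2 * 1 * 1"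
    unfolding deriv_eq w_def
    using assms abs_sin_x_le_abs_x[of u] abs_sin_minus_mult_cos_le_square[of u]
    by (intro mult_mono) auto
  moreover have "u^2 * \<bar>sinc_square_deriv u\<bar> \<le> 4"
  proof -
    have "w \<le> \<bar>sin u\<bar> + \<bar>u * cos u\<bar>"
      unfolding w_def by (rule abs_triangle_ineq4)
    also have "\<dots> \<le> u + u * 1"
      using assms abs_sin_x_le_abs_x[of u] by (intro add_mono) (auto simp: abs_mult)
    finally have "\<bar>sin u\<bar> * (w / u) \<le> 1 * 2"
      using assms by (intro mult_mono) (auto simp: field_simps w_def)
    then show ?thesis
      using assms by (simp add: deriv_eq)
  qed
  ultimately have "\<bar>sinc_square_deriv u\<bar> * (1 + u^2) \<le> 6"
    by (simp add: algebra_simps)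
  then show ?thesis
    by (simp add: field_simps add_pos_nonneg)
qed

lemma abs_sinc_square_diff_le:
  assumes "0 \<le> u" "u \<le> v"
  shows "\<bar>sinc_square v - sinc_square u\<bar> \<le> 6 * (arctan v - arctan u)"
proof (cases "u = v")
  case False
  have "norm (sinc_square v - sinc_square u) \<le> 6 * arctan v - 6 * arctan u"
  proof (rule differentiable_bound_general)
    show "continuous_on {u..v} sinc_square"
      using isCont_sinc_square by (intro continuous_at_imp_continuous_on ballI)
    show "continuous_on {u..v} (\<lambda>t. 6 * arctan t)"
      by (intro continuous_intros)
  next
    fix t assume t: "u < t" "t < v"
    then show "(sinc_square has_vector_derivative sinc_square_deriv t) (at t)"
      using assms sinc_square_has_derivative
      by (simp flip: has_real_derivative_iff_has_vector_derivative)
    show "((\<lambda>t. 6 * arctan t) has_vector_derivative 6 * inverse (1 + t^2)) (at t)"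
      unfolding has_real_derivative_iff_has_vector_derivative[symmetric]
      by (intro DERIV_cmult DERIV_arctan)
    show "norm (sinc_square_deriv t) \<le> 6 * inverse (1 + t^2)"
      using t assms abs_sinc_square_deriv_le by simp
  qed (use assms False in simp)
  then show ?thesis
    by (simp add: algebra_simps)
qed simp

lemma variation_sinc_square_le: "variation (\<lambda>n. sinc_square (real n * h)) 0 N \<le> 3 * pi"
proof -
  define r where "r n = real n * \<bar>h\<bar>" for n :: nat
  have "\<bar>sinc_square (real n * h) - sinc_square (real (Suc n) * h)\<bar>
      \<le> 6 * (arctan (r (Suc n)) - arctan (r n))" for n
  proof -
    have "\<bar>sinc_square (r (Suc n)) - sinc_square (r n)\<bar> \<le> 6 * (arctan (r (Suc n)) - arctan (r n))"
      by (intro abs_sinc_square_diff_le) (auto simp: r_def intro: mult_right_mono)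
    moreover have "sinc_square (r m) = sinc_square (real m * h)" for m
      using sinc_square_abs[of "real m * h"] by (simp add: r_def abs_mult)
    ultimately show ?thesis
      by (simp only: abs_minus_commute)
  qed
  then have "variation (\<lambda>n. sinc_square (real n * h)) 0 N
      \<le> (\<Sum>n=0..<N. 6 * (arctan (r (Suc n)) - arctan (r n)))"
    unfolding variation_def by (intro sum_mono)
  also have "\<dots> = 6 * arctan (r N)"
    using sum_Suc_diff'[of 0 N "\<lambda>n. arctan (r n)"]
    by (simp only: r_def flip: sum_distrib_left) simp
  also have "\<dots> \<le> 3 * pi"
    using arctan_ubound[of "r N"] by simp
  finally show ?thesis .
qed

lemma riemann_summation_regular:
  fixes a :: "nat \<Rightarrow> real"
  assumes "a sums s"
  shows "((\<lambda>h. \<Sum>n. a n * sinc_square (real n * h)) \<longlongrightarrow> s) (at 0)"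
proof (rule suminf_mult_tendsto_if_variation_bounded[OF assms,
      where S = UNIV and B = 1 and V = "3 * pi"])
  fix n
  have "isCont (\<lambda>h. sinc_square (real n * h)) 0"
    by (rule isCont_o2[OF _ isCont_sinc_square]) simp
  then show "((\<lambda>h. sinc_square (real n * h)) \<longlongrightarrow> 1) (at 0)"
    by (simp add: isCont_def sinc_square_0)
qed (auto simp: abs_sinc_square_le_1 variation_sinc_square_le)

section \<open>Symmetric second derivatives\<close>

definition has_symmetric_second_derivative :: "(real \<Rightarrow> real) \<Rightarrow> real \<Rightarrow> real \<Rightarrow> bool" where
  "has_symmetric_second_derivative F D x \<longleftrightarrow>
    ((\<lambda>t. (F (x + t) + F (x - t) - 2 * F x) / t^2) \<longlongrightarrow> D) (at 0)"

lemma has_symmetric_second_derivative_diff_quadratic: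
  assumes "has_symmetric_second_derivative F D y"
  shows "has_symmetric_second_derivative (\<lambda>y. F y - (p * (y - x)^2 + q * (y - x))) (D - 2 * p) y"
  unfolding has_symmetric_second_derivative_def
proof (rule Lim_transform_eventually)
  show "((\<lambda>t. (F (y + t) + F (y - t) - 2 * F y) / t^2 - 2 * p) \<longlongrightarrow> D - 2 * p) (at 0)"
    using assms unfolding has_symmetric_second_derivative_def by (intro tendsto_diff tendsto_const)
  let ?Q = "\<lambda>y. p * (y - x)^2 + q * (y - x)"
  have "?Q (y + t) + ?Q (y - t) - 2 * ?Q y = 2 * p * t^2" for t
    by (simp add: power2_eq_square algebra_simps)
  then have "(F (y + t) - ?Q (y + t)) + (F (y - t) - ?Q (y - t)) - 2 * (F y - ?Q y)
      = F (y + t) + F (y - t) - 2 * F y - 2 * p * t^2" for t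
    by (smt (verit))
  then have "(F (y + t) + F (y - t) - 2 * F y) / t^2 - 2 * p
      = ((F (y + t) - ?Q (y + t)) + (F (y - t) - ?Q (y - t)) - 2 * (F y - ?Q y)) / t^2" if "t \<noteq> 0" for t
    using that by (simp only: diff_divide_distrib) simp
  then show "\<forall>\<^sub>F t in at 0. (F (y + t) + F (y - t) - 2 * F y) / t^2 - 2 * p
      = ((F (y + t) - ?Q (y + t)) + (F (y - t) - ?Q (y - t)) - 2 * (F y - ?Q y)) / t^2"
    by (rule eventually_mono[OF eventually_neq_at_within])
qed

lemma has_symmetric_second_derivative_nonpos_if_max:
  assumes "has_symmetric_second_derivative F D y" "a < y" "y < b"
    and maximal: "\<And>z. a \<le> z \<Longrightarrow> z \<le> b \<Longrightarrow> F z \<le> F y"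
  shows "D \<le> 0"
proof (rule tendsto_upperbound)
  show "((\<lambda>t. (F (y + t) + F (y - t) - 2 * F y) / t^2) \<longlongrightarrow> D) (at 0)"
    using assms(1) unfolding has_symmetric_second_derivative_def .
  show "\<forall>\<^sub>F t in at 0. (F (y + t) + F (y - t) - 2 * F y) / t^2 \<le> 0"
    unfolding eventually_at
  proof (intro exI[of _ "min (y - a) (b - y)"] conjI ballI impI)
    fix t :: real assume "t \<noteq> 0 \<and> dist t 0 < min (y - a) (b - y)"
    then have "F (y + t) \<le> F y" "F (y - t) \<le> F y"
      by (auto simp: dist_real_def intro!: maximal)
    then show "(F (y + t) + F (y - t) - 2 * F y) / t^2 \<le> 0"
      by (intro divide_nonpos_nonneg) auto
  qed (use assms(2,3) in auto)
qed simp

lemma symmetric_second_difference_ge: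
  assumes cont: "continuous_on {x - H..x + H} F" and "H > 0"
    and deriv: "\<And>y. \<bar>y - x\<bar> < H \<Longrightarrow> has_symmetric_second_derivative F (D y) y"
    and lower: "\<And>y. \<bar>y - x\<bar> < H \<Longrightarrow> c < D y"
  shows "c * H^2 \<le> F (x + H) + F (x - H) - 2 * F x"
proof (rule ccontr)
  assume contrary: "\<not> ?thesis"
  define q where "q = (F (x + H) - F (x - H)) / (2 * H)"
  define E where "E y = F y - (c / 2 * (y - x)^2 + q * (y - x))" for y
  have "E (x + H) = E (x - H)"
    using \<open>H > 0\<close> by (simp add: E_def q_def field_simps)
  moreover have "E (x + H) + E (x - H) < 2 * E x"
    using contrary by (simp add: E_def field_simps)
  ultimately have ends: "E (x + H) < E x" "E (x - H) < E x"
    by auto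
  have "continuous_on {x - H..x + H} E"
    unfolding E_def by (intro continuous_intros cont)
  then obtain y where y: "y \<in> {x - H..x + H}" "\<And>z. z \<in> {x - H..x + H} \<Longrightarrow> E z \<le> E y"
    using continuous_attains_sup[of "{x - H..x + H}" E] \<open>H > 0\<close> by auto
  have "E x \<le> E y"
    using y(2) \<open>H > 0\<close> by auto
  with ends have "y \<noteq> x + H" "y \<noteq> x - H"
    by auto
  with y(1) have interior: "x - H < y" "y < x + H" "\<bar>y - x\<bar> < H"
    by auto
  have "has_symmetric_second_derivative E (D y - 2 * (c / 2)) y"
    unfolding E_def using deriv[OF interior(3)] by (rule has_symmetric_second_derivative_diff_quadratic)
  then have "D y - 2 * (c / 2) \<le> 0"
    using interior(1,2) y(2) by (rule has_symmetric_second_derivative_nonpos_if_max) auto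
  with lower[OF interior(3)] show False
    by simp
qed

section \<open>Riemann's function\<close>

definition sine_series :: "(nat \<Rightarrow> real) \<Rightarrow> real \<Rightarrow> real" where
  "sine_series b x = (\<Sum>n. b n * sin (real n * x))"

definition riemann_function :: "(nat \<Rightarrow> real) \<Rightarrow> real \<Rightarrow> real" where
  "riemann_function b x = (\<Sum>n. b n * sin (real n * x) / (real n)^2)"

lemma riemann_function_0: "riemann_function b 0 = 0"
  by (simp add: riemann_function_def)

lemma uniform_limit_riemann_function:
  assumes "Bseq b"
  shows "uniform_limit UNIV (\<lambda>N x. \<Sum>n<N. b n * sin (real n * x) / (real n)^2)
    (riemann_function b) sequentially"
proof -
  obtain B where B: "B > 0" "\<And>n. norm (b n) \<le> B"
    using assms by (rule BseqE) blast
  have "norm (b n * sin (real n * x) / (real n)^2) \<le> B * inverse ((real n)^2)" for n x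
  proof -
    have "\<bar>b n\<bar> * \<bar>sin (real n * x)\<bar> \<le> B * 1"
      using B by (intro mult_mono) auto
    then show ?thesis
      by (simp add: abs_mult divide_inverse mult_right_mono)
  qed
  moreover have "summable (\<lambda>n. B * inverse ((real n)^2))"
    by (intro summable_mult inverse_power_summable) simp
  ultimately show ?thesis
    unfolding riemann_function_def[abs_def] by (rule Weierstrass_m_test)
qed

lemma riemann_function_sums:
  assumes "Bseq b"
  shows "(\<lambda>n. b n * sin (real n * x) / (real n)^2) sums riemann_function b x"
  using tendsto_uniform_limitI[OF uniform_limit_riemann_function[OF assms]] by (simp add: sums_def)

lemma continuous_on_riemann_function:
  assumes "Bseq b"
  shows "continuous_on S (riemann_function b)"
proof -
  have "continuous_on UNIV (riemann_function b)"
    by (rule uniform_limit_theorem[OF _ uniform_limit_riemann_function[OF assms]])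
       (auto simp: divide_inverse intro!: always_eventually continuous_intros)
  then show ?thesis
    by (rule continuous_on_subset) simp
qed

lemma sine_term_second_difference:
  assumes "t \<noteq> 0"
  shows "(b * sin (real n * (x + t)) / (real n)^2 + b * sin (real n * (x - t)) / (real n)^2
            - 2 * (b * sin (real n * x) / (real n)^2)) / t^2
       = - (b * sin (real n * x) * sinc_square (real n * (t / 2)))"
proof (cases "n = 0")
  case False
  have "sin (real n * (x + t)) + sin (real n * (x - t)) - 2 * sin (real n * x)
      = 2 * sin (real n * x) * (cos (2 * (real n * (t / 2))) - 1)"
    by (simp add: distrib_left right_diff_distrib sin_add sin_diff)
  also have "\<dots> = - 4 * sin (real n * x) * (sin (real n * (t / 2)))^2"
    unfolding cos_double_sin by simp
  finally have sin_eq: "sin (real n * (x - t)) = 2 * sin (real n * x) - sin (real n * (x + t))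
      - 4 * sin (real n * x) * (sin (real n * (t / 2)))^2"
    by simp
  have "sinc_square (real n * (t / 2)) = (sin (real n * (t / 2)) / (real n * (t / 2)))^2"
    using False assms by (simp add: sinc_square_def)
  then show ?thesis
    unfolding sin_eq using False assms by (simp add: field_simps)
qed simp

lemma riemann_function_has_symmetric_second_derivative:
  assumes "Bseq b" and conv: "(\<lambda>n. b n * sin (real n * x)) sums s"
  shows "has_symmetric_second_derivative (riemann_function b) (- s) x"
  unfolding has_symmetric_second_derivative_def
proof (rule Lim_transform_eventually)
  let ?R = "riemann_function b"
  have "filterlim (\<lambda>t::real. t / 2) (at 0) (at 0)"
    unfolding filterlim_at by (auto intro!: tendsto_eq_intros simp: eventually_at_filter)
  with riemann_summation_regular[OF conv]
  have "((\<lambda>t. \<Sum>n. b n * sin (real n * x) * sinc_square (real n * (t / 2))) \<longlongrightarrow> s) (at 0)"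
    by (rule filterlim_compose)
  then show "((\<lambda>t. - (\<Sum>n. b n * sin (real n * x) * sinc_square (real n * (t / 2)))) \<longlongrightarrow> - s) (at 0)"
    by (rule tendsto_minus)
  have "- (\<Sum>n. b n * sin (real n * x) * sinc_square (real n * (t / 2)))
      = (?R (x + t) + ?R (x - t) - 2 * ?R x) / t^2" if "t \<noteq> 0" for t
  proof -
    have "(\<lambda>n. - (b n * sin (real n * x) * sinc_square (real n * (t / 2)))) sums
        ((?R (x + t) + ?R (x - t) - 2 * ?R x) / t^2)"
      unfolding sine_term_second_difference[OF that, symmetric]
      by (intro sums_divide sums_diff sums_add sums_mult riemann_function_sums assms)
    from sums_minus[OF this] show ?thesis
      by (simp add: sums_iff)
  qed
  then show "\<forall>\<^sub>F t in at 0. - (\<Sum>n. b n * sin (real n * x) * sinc_square (real n * (t / 2)))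
      = (?R (x + t) + ?R (x - t) - 2 * ?R x) / t^2"
    by (rule eventually_mono[OF eventually_neq_at_within])
qed

lemma riemann_function_doubling_le:
  assumes "Bseq b" and conv: "\<And>x. summable (\<lambda>n. b n * sin (real n * x))"
    and "x > 0" and upper: "\<And>y. \<bar>y\<bar> < 2 * x \<Longrightarrow> sine_series b y < e"
  shows "2 * riemann_function b x - riemann_function b (2 * x) \<le> e * x^2"
proof -
  have "- e * x^2 \<le> riemann_function b (x + x) + riemann_function b (x - x) - 2 * riemann_function b x"
  proof (rule symmetric_second_difference_ge)
    show "has_symmetric_second_derivative (riemann_function b) (- sine_series b y) y" for y
      unfolding sine_series_def
      using assms(1) summable_sums[OF conv] by (rule riemann_function_has_symmetric_second_derivative)
    show "- e < - sine_series b y" if "\<bar>y - x\<bar> < x" for y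
      using upper[of y] that by auto
  qed (use assms continuous_on_riemann_function in auto)
  then show ?thesis
    by (simp add: riemann_function_0)
qed

section \<open>Weighted means of the coefficients\<close>

lemma DERIV_one_minus_cos_square:
  "((\<lambda>x. b * (1 - cos (real n * x))^2 / (real n)^3) has_real_derivative
    2 * (b * sin (real n * x) / (real n)^2) - b * sin (real n * (2 * x)) / (real n)^2) (at x)"
proof -
  have "((\<lambda>x. b * (1 - cos (real n * x))^2 / (real n)^3) has_real_derivative
      b * (2 * (1 - cos (real n * x)) * (sin (real n * x) * real n)) / (real n)^3) (at x)"
    by (intro DERIV_cdivide DERIV_cmult) (auto intro!: derivative_eq_intros)
  moreover have "sin (real n * (2 * x)) = 2 * sin (real n * x) * cos (real n * x)"
    using sin_double[of "real n * x"] by (simp add: mult_ac)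
  then have "b * (2 * (1 - cos (real n * x)) * (sin (real n * x) * real n)) / (real n)^3
      = 2 * (b * sin (real n * x) / (real n)^2) - b * sin (real n * (2 * x)) / (real n)^2"
    by (cases "n = 0") (simp_all add: field_simps power2_eq_square power3_eq_cube)
  ultimately show ?thesis
    by simp
qed

lemma
  assumes "Bseq b"
  shows summable_one_minus_cos_square: "summable (\<lambda>n. b n * (1 - cos (real n * x))^2 / (real n)^3)"
    and DERIV_suminf_one_minus_cos_square:
      "((\<lambda>x. \<Sum>n. b n * (1 - cos (real n * x))^2 / (real n)^3) has_real_derivative
        2 * riemann_function b x - riemann_function b (2 * x)) (at x)"
proof -
  let ?K = "\<lambda>n x. b n * (1 - cos (real n * x))^2 / (real n)^3"
  let ?D = "\<lambda>x. 2 * riemann_function b x - riemann_function b (2 * x)"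
  note limit = uniform_limit_riemann_function[OF assms]
  have doubled: "uniform_limit UNIV (\<lambda>N x. \<Sum>n<N. b n * sin (real n * (2 * x)) / (real n)^2)
      (\<lambda>x. riemann_function b (2 * x)) sequentially"
    by (rule uniform_limit_compose'[OF limit]) simp
  have "uniform_limit UNIV (\<lambda>N x. 2 * (\<Sum>n<N. b n * sin (real n * x) / (real n)^2)
      - (\<Sum>n<N. b n * sin (real n * (2 * x)) / (real n)^2)) ?D sequentially"
    by (intro uniform_limit_intros limit doubled)
  then have "uniform_limit UNIV (\<lambda>N x. \<Sum>n<N. 2 * (b n * sin (real n * x) / (real n)^2)
      - b n * sin (real n * (2 * x)) / (real n)^2) ?D sequentially"
    by (simp only: sum_subtractf sum_distrib_left)
  from has_field_derivative_series[OF convex_UNIV DERIV_one_minus_cos_square this, of 0]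
  obtain g where g: "\<And>x. (\<lambda>n. ?K n x) sums g x" "\<And>x. (g has_real_derivative ?D x) (at x)"
    by auto
  from g(1) show "summable (\<lambda>n. ?K n x)"
    by (rule sums_summable)
  have "g = (\<lambda>x. \<Sum>n. ?K n x)"
    using sums_unique[OF g(1)] by blast
  with g(2) show "((\<lambda>x. \<Sum>n. ?K n x) has_real_derivative ?D x) (at x)"
    by simp
qed

lemma weighted_sum_le_suminf_one_minus_cos_square:
  assumes nonneg: "\<And>n. n \<ge> 1 \<Longrightarrow> b n \<ge> 0" and "Bseq b" and h: "0 \<le> h" "real k * h \<le> 1"
  shows "(\<Sum>n=1..k. real n * b n) * (h^4 / 16) \<le> (\<Sum>n. b n * (1 - cos (real n * h))^2 / (real n)^3)"
proof -
  have "(\<Sum>n=1..k. real n * b n) * (h^4 / 16)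
      \<le> (\<Sum>n=1..k. b n * (1 - cos (real n * h))^2 / (real n)^3)"
    unfolding sum_distrib_right
  proof (rule sum_mono)
    fix n assume n: "n \<in> {1..k}"
    have "real n * h \<le> real k * h"
      using n h by (intro mult_right_mono) auto
    then have "\<bar>real n * h\<bar> \<le> 1"
      using h by simp
    then have "((real n * h)^2 / 4)^2 \<le> (1 - cos (real n * h))^2"
      by (intro power_mono one_minus_cos_ge_quarter_square) auto
    then have "b n * ((real n * h)^2 / 4)^2 / (real n)^3 \<le> b n * (1 - cos (real n * h))^2 / (real n)^3"
      using nonneg n by (intro divide_right_mono mult_left_mono) auto
    also have "b n * ((real n * h)^2 / 4)^2 / (real n)^3 = real n * b n * (h^4 / 16)"
      using n by (simp add: field_simps eval_nat_numeral)
    finally show "real n * b n * (h^4 / 16) \<le> b n * (1 - cos (real n * h))^2 / (real n)^3" .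
  qed
  also have "\<dots> \<le> (\<Sum>n. b n * (1 - cos (real n * h))^2 / (real n)^3)"
  proof (rule sum_le_suminf)
    show "0 \<le> b n * (1 - cos (real n * h))^2 / (real n)^3" for n
      using nonneg[of n] by (cases "n = 0") auto
  qed (use summable_one_minus_cos_square[OF assms(2)] in auto)
  finally show ?thesis .
qed

lemma weighted_sum_le:
  assumes nonneg: "\<And>n. n \<ge> 1 \<Longrightarrow> b n \<ge> 0" and "Bseq b"
    and conv: "\<And>x. summable (\<lambda>n. b n * sin (real n * x))"
    and "k \<ge> 1" and upper: "\<And>y. \<bar>y\<bar> < 2 / real k \<Longrightarrow> sine_series b y < e"
  shows "(\<Sum>n=1..k. real n * b n) \<le> 16 * e * real k"
proof -
  define h where "h = 1 / real k"
  define K where "K x = (\<Sum>n. b n * (1 - cos (real n * x))^2 / (real n)^3)" for x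
  have h: "h > 0" "real k * h = 1"
    using \<open>k \<ge> 1\<close> by (auto simp: h_def)
  have "0 < e"
    using upper[of 0] \<open>k \<ge> 1\<close> by (simp add: sine_series_def)
  have "\<exists>z>0. z < h \<and> K h - K 0 = (h - 0) * (2 * riemann_function b z - riemann_function b (2 * z))"
    unfolding K_def using h DERIV_suminf_one_minus_cos_square[OF assms(2)] by (intro MVT2) auto
  then obtain z where z: "0 < z" "z < h"
    and K: "K h = h * (2 * riemann_function b z - riemann_function b (2 * z))"
    by (auto simp: K_def)
  have "2 * riemann_function b z - riemann_function b (2 * z) \<le> e * z^2"
    using assms(2) conv z(1)
  proof (rule riemann_function_doubling_le)
    fix y assume "\<bar>y\<bar> < 2 * z"
    then show "sine_series b y < e"
      using z by (intro upper) (simp add: h_def)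
  qed
  also have "\<dots> \<le> e * h^2"
    using z \<open>0 < e\<close> by (intro mult_left_mono power_mono) auto
  finally have "K h \<le> h * (e * h^2)"
    unfolding K using h by (intro mult_left_mono) auto
  moreover have "(\<Sum>n=1..k. real n * b n) * (h^4 / 16) \<le> K h"
    unfolding K_def using nonneg assms(2) h
    by (intro weighted_sum_le_suminf_one_minus_cos_square) auto
  ultimately have "((\<Sum>n=1..k. real n * b n) * h / 16) * h^3 \<le> e * h^3"
    by (simp add: eval_nat_numeral mult_ac)
  then have "(\<Sum>n=1..k. real n * b n) * h \<le> 16 * e"
    using h by simp
  then show ?thesis
    using \<open>k \<ge> 1\<close> by (simp add: h_def field_simps)
qed

lemma weighted_mean_tendsto_0:
  assumes nonneg: "\<And>n. n \<ge> 1 \<Longrightarrow> b n \<ge> 0"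
    and conv: "\<And>x. summable (\<lambda>n. b n * sin (real n * x))"
    and cont: "isCont (sine_series b) 0"
  shows "(\<lambda>k. (\<Sum>n=1..k. real n * b n) / real k) \<longlonglongrightarrow> 0"
proof (rule LIMSEQ_I)
  fix r :: real assume "r > 0"
  define e where "e = r / 32"
  have e: "e > 0" "16 * e < r"
    using \<open>r > 0\<close> by (auto simp: e_def)
  have "b \<longlonglongrightarrow> 0"
    using summable_LIMSEQ_zero[OF conv] by (rule cantor_lebesgue_sin)
  then have "Bseq b"
    by (intro convergent_imp_Bseq convergentI)
  have "sine_series b 0 = 0"
    by (simp add: sine_series_def)
  then obtain d where d: "d > 0" "\<And>y. \<bar>y\<bar> < d \<Longrightarrow> \<bar>sine_series b y\<bar> < e"
    using cont e(1) unfolding continuous_at_eps_delta by (auto simp: dist_real_def)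
  obtain k0 where k0: "real k0 > 2 / d"
    using reals_Archimedean2 by blast
  have "norm ((\<Sum>n=1..k. real n * b n) / real k - 0) < r" if "k \<ge> Suc k0" for k
  proof -
    have "2 / d < real k"
      using k0 that by linarith
    then have "2 / real k < d"
      using d that by (simp add: field_simps)
    then have "(\<Sum>n=1..k. real n * b n) \<le> 16 * e * real k"
      using nonneg \<open>Bseq b\<close> conv that d(2) by (intro weighted_sum_le) (auto simp: abs_less_iff)
    then have "(\<Sum>n=1..k. real n * b n) / real k \<le> 16 * e"
      using that by (simp add: field_simps)
    moreover have "0 \<le> (\<Sum>n=1..k. real n * b n) / real k"
      using nonneg by (intro divide_nonneg_nonneg sum_nonneg mult_nonneg_nonneg) auto
    ultimately show ?thesis
      using e by simp
  qed
  then show "\<exists>k0. \<forall>k\<ge>k0. norm ((\<Sum>n=1..k. real n * b n) / real k - 0) < r"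
    by blast
qed

section \<open>From weighted means to coefficients\<close>

lemma sum_upper_half_shift_le:
  assumes nonneg: "\<And>n. n \<ge> 1 \<Longrightarrow> b n \<ge> 0" and "k \<ge> 1" "i \<le> j"
  shows "real k / 2 * (\<Sum>m=k - k div 2..k. b (m + i)) \<le> (\<Sum>n=1..k+j. real n * b n)"
proof -
  have "real k / 2 * (\<Sum>m=k - k div 2..k. b (m + i))
      \<le> (\<Sum>m=k - k div 2..k. real (m + i) * b (m + i))"
    unfolding sum_distrib_left
  proof (intro sum_mono mult_right_mono)
    fix m assume "m \<in> {k - k div 2..k}"
    then have "k \<le> 2 * m" "m \<ge> 1"
      using \<open>k \<ge> 1\<close> by auto
    then show "real k / 2 \<le> real (m + i)" "0 \<le> b (m + i)"
      using nonneg by auto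
  qed
  also have "\<dots> = (\<Sum>n=k - k div 2 + i..k+i. real n * b n)"
    by (rule sum.shift_bounds_cl_nat_ivl[symmetric])
  also have "\<dots> \<le> (\<Sum>n=1..k+j. real n * b n)"
    using assms by (intro sum_mono2) auto
  finally show ?thesis .
qed

context dyadic_variation_bounded
begin

lemma le_window_sum:
  assumes "m \<ge> 1" "m \<le> k" "k \<le> 2 * m"
  shows "b k \<le> (1 + M) * (\<Sum>i<N0. b (m + i))"
proof -
  have member: "b (m + i) \<le> (\<Sum>i<N0. b (m + i))" if "i < N0" for i
    using that nonneg assms(1) by (intro member_le_sum) auto
  have "b n \<le> (\<Sum>i<N0. b (m + i))" if "n \<in> {m..<m+N0}" for n
    using member[of "n - m"] that by auto
  then have Max_le: "Max (b ` {m..<m+N0}) \<le> (\<Sum>i<N0. b (m + i))"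
    using N0_pos by (subst Max_le_iff) auto
  have "b k - b m \<le> variation b m k"
    using abs_diff_le_variation[OF assms(2), of b] by linarith
  also have "\<dots> \<le> variation b m (Suc (2 * m))"
    using assms by (intro variation_mono) auto
  also have "\<dots> \<le> M * (\<Sum>i<N0. b (m + i))"
    using Max_le M_pos by (intro order_trans[OF dyadic_variation_le[OF assms(1)]] mult_left_mono) auto
  finally show ?thesis
    using member[of 0] N0_pos by (simp add: algebra_simps)
qed

lemma square_mult_le_weighted_sum:
  assumes "k \<ge> 1"
  shows "(real k)^2 * b k \<le> 4 * (1 + M) * real N0 * (\<Sum>n=1..k+N0. real n * b n)"
proof -
  define I where "I = {k - k div 2..k}"
  have "real k / 2 * b k \<le> real (card I) * b k"
    using nonneg assms by (intro mult_right_mono) (auto simp: I_def)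
  also have "\<dots> = (\<Sum>m\<in>I. b k)"
    by simp
  also have "\<dots> \<le> (\<Sum>m\<in>I. (1 + M) * (\<Sum>i<N0. b (m + i)))"
    using assms by (intro sum_mono le_window_sum) (auto simp: I_def)
  also have "\<dots> = (1 + M) * (\<Sum>i<N0. \<Sum>m\<in>I. b (m + i))"
    by (subst sum.swap) (simp add: sum_distrib_left)
  finally have "real k / 2 * (real k / 2 * b k) \<le> real k / 2 * ((1 + M) * (\<Sum>i<N0. \<Sum>m\<in>I. b (m + i)))"
    by (rule mult_left_mono) simp
  also have "\<dots> = (1 + M) * (\<Sum>i<N0. real k / 2 * (\<Sum>m\<in>I. b (m + i)))"
    by (simp only: mult.left_commute[of "real k / 2"] flip: sum_distrib_left)
  also have "\<dots> \<le> (1 + M) * (\<Sum>i<N0. \<Sum>n=1..k+N0. real n * b n)"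
    unfolding I_def using M_pos nonneg assms
    by (intro mult_left_mono sum_mono sum_upper_half_shift_le) auto
  finally show ?thesis
    by (simp add: power2_eq_square algebra_simps)
qed

lemma of_nat_mult_tendsto_0_if_weighted_mean:
  assumes "(\<lambda>k. (\<Sum>n=1..k. real n * b n) / real k) \<longlonglongrightarrow> 0"
  shows "(\<lambda>n. real n * b n) \<longlonglongrightarrow> 0"
proof (rule tendsto_sandwich[of "\<lambda>_. 0"])
  define T where "T k = (\<Sum>n=1..k. real n * b n)" for k
  have "(\<lambda>k. T (k + N0) / real (k + N0)) \<longlonglongrightarrow> 0"
    using assms unfolding T_def by (rule LIMSEQ_ignore_initial_segment)
  moreover have "(\<lambda>k. 1 + real N0 / real k) \<longlonglongrightarrow> 1 + 0"
    by (intro tendsto_add tendsto_const lim_const_over_n)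
  ultimately have "(\<lambda>k. 4 * (1 + M) * real N0 * (T (k + N0) / real (k + N0) * (1 + real N0 / real k))) \<longlonglongrightarrow>
      4 * (1 + M) * real N0 * (0 * (1 + 0))"
    by (intro tendsto_mult tendsto_const)
  then show "(\<lambda>k. 4 * (1 + M) * real N0 * (T (k + N0) / real (k + N0) * (1 + real N0 / real k))) \<longlonglongrightarrow> 0"
    by simp
  have "real k * b k \<le> 4 * (1 + M) * real N0 * (T (k + N0) / real (k + N0) * (1 + real N0 / real k))"
    if "k \<ge> 1" for k
  proof -
    have "real k * b k \<le> 4 * (1 + M) * real N0 * (T (k + N0) / real k)"
      using square_mult_le_weighted_sum[OF that] that
      by (simp add: T_def field_simps power2_eq_square)
    also have "T (k + N0) / real k = T (k + N0) / real (k + N0) * (1 + real N0 / real k)"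
    proof -
      have "1 + real N0 / real k = real (k + N0) / real k"
        using that by (simp add: field_simps)
      then show ?thesis
        using that by (simp only: times_divide_times_eq) simp
    qed
    finally show ?thesis by simp
  qed
  then show "\<forall>\<^sub>F k in sequentially. real k * b k
      \<le> 4 * (1 + M) * real N0 * (T (k + N0) / real (k + N0) * (1 + real N0 / real k))"
    by (auto simp: eventually_sequentially)
  show "\<forall>\<^sub>F k in sequentially. 0 \<le> real k * b k"
    using nonneg by (auto simp: eventually_sequentially intro!: exI[of _ 1])
qed simp

end

section \<open>The equivalences\<close>

lemma uniformly_convergent_sum_from_1_iff:
  fixes g :: "nat \<Rightarrow> 'a \<Rightarrow> 'b::real_normed_vector"
  assumes "\<And>x. x \<in> S \<Longrightarrow> g 0 x = 0"
  shows "uniformly_convergent_on S (\<lambda>N x. \<Sum>n=1..N. g n x) \<longleftrightarrow>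
    uniformly_convergent_on S (\<lambda>N x. \<Sum>n<N. g n x)"
proof -
  have "(\<Sum>n=1..N. g n x) = (\<Sum>n<Suc N. g n x)" if "x \<in> S" for N x
    using assms[OF that]
    by (simp add: sum.lessThan_Suc_shift sum.atLeast1_atMost_eq del: sum.lessThan_Suc)
  then have "uniform_limit S (\<lambda>N x. \<Sum>n=1..N. g n x) l sequentially \<longleftrightarrow>
      uniform_limit S (\<lambda>N x. \<Sum>n<Suc N. g n x) l sequentially" for l
    by (intro uniform_limit_cong) auto
  then show ?thesis
    unfolding uniformly_convergent_on_def
    using filterlim_sequentially_Suc[of "\<lambda>N x. \<Sum>n<N. g n x"] by auto
qed

lemma
  assumes "uniformly_convergent_on UNIV (\<lambda>N x. \<Sum>n<N. b n * sin (real n * x))"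
  shows summable_if_uniformly_convergent: "summable (\<lambda>n. b n * sin (real n * x))"
    and continuous_on_if_uniformly_convergent: "continuous_on UNIV (sine_series b)"
proof -
  have limit: "uniform_limit UNIV (\<lambda>N x. \<Sum>n<N. b n * sin (real n * x)) (sine_series b) sequentially"
    using assms unfolding sine_series_def[abs_def] by (rule uniform_limit_suminf)
  then show "summable (\<lambda>n. b n * sin (real n * x))"
    using tendsto_uniform_limitI[OF limit, of x] by (auto simp: summable_def sums_def)
  show "continuous_on UNIV (sine_series b)"
    by (rule uniform_limit_theorem[OF _ limit]) (auto intro!: always_eventually continuous_intros)
qed

theorem theorem2:
  fixes b :: "nat \<Rightarrow> real"
  assumes nonneg: "\<And>n. n \<ge> 1 \<Longrightarrow> b n \<ge> 0"
    and cond: "\<exists>N0::nat. N0 \<ge> 1 \<and> (\<exists>M::real. M > 0 \<and>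
          (\<forall>m::nat. m \<ge> 1 \<longrightarrow>
             (\<Sum>n=m..2*m. \<bar>b n - b (n+1)\<bar>) \<le> M * Max (b ` {m..<m+N0})))"
  shows "(uniformly_convergent_on UNIV (\<lambda>N x. \<Sum>n\<in>{1..N}. b n * sin (real n * x))
            \<longleftrightarrow> (\<lambda>n. real n * b n) \<longlonglongrightarrow> 0)
       \<and> (((\<forall>x. summable (\<lambda>n. b n * sin (real n * x))) \<and>
             continuous_on UNIV (\<lambda>x. \<Sum>n. b n * sin (real n * x)))
            \<longleftrightarrow> (\<lambda>n. real n * b n) \<longlonglongrightarrow> 0)"
    (is "(?unif \<longleftrightarrow> ?lim) \<and> (?cont \<longleftrightarrow> ?lim)")
proof -
  obtain N0 M where "dyadic_variation_bounded b N0 M"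
    using nonneg cond
    by (auto simp: dyadic_variation_bounded_def variation_def atLeastLessThanSuc_atLeastAtMost)
  then interpret dyadic_variation_bounded b N0 M .
  have "?lim \<Longrightarrow> ?unif"
    using uniformly_convergent_sine_series by (subst uniformly_convergent_sum_from_1_iff) auto
  moreover have "?unif \<Longrightarrow> ?cont"
    using summable_if_uniformly_convergent[of b] continuous_on_if_uniformly_convergent[of b]
    by (subst (asm) uniformly_convergent_sum_from_1_iff) (auto simp: sine_series_def[abs_def])
  moreover have "?cont \<Longrightarrow> ?lim"
    using nonneg
    by (intro of_nat_mult_tendsto_0_if_weighted_mean weighted_mean_tendsto_0)
      (auto simp: sine_series_def[abs_def] continuous_on_eq_continuous_at)
  ultimately show ?thesis by blast
qed

end
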